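(* Let $S$ and $J$ be intervals, suppose that for all $s\in S$ we are given an interval $I_{s}\subset\, ]0, +\infty[$ and a function $\xi_s\colon I_s\to\mathbb{R}$, and let $$B= \{(x, s) : s\in S,\ x\in I_{s}\}\subset \mathbb{R}^{2}.$$ Let $\gamma\colon J\times S\to\mathbb{R}$ and $\eta\colon J\times S\to S$ be functions. Suppose further that there is $s^{\ast}\in S$ such that (i) the mapping $J\ni \lambda \mapsto \eta(\lambda, s^* )$ is constant, while the mapping $I_{s^{*}}\ni x\mapsto \xi_{s^*}(x)$ is philandering and measurable; (ii) we have $$\xi_{s^{*}}(\lambda x)= \gamma(\lambda, s^{*})\,\xi_{\eta(\lambda, s^{*})}(x)$$ for all $\lambda\in J$ and $(x, s^* )\in B$ for which also $(\lambda x, s^* )\in B$; (iii) the set $$\{ (\lambda, x) : \lambda\in J,\ (x, s^* )\in B \text{ for which also } (\lambda x, s^* )\in B\} \subset\, ]0, +\infty[^{2}$$ is open and connected. Then there exist constants $\kappa(s^* )$ and $\rho(s^* )$ such that $$\xi_{s^*}(x)= \kappa(s^* )\,x^{\rho(s^* )}\qquad (x\in I_{s^*}).$$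
   Context: Every interval has positive length. A function is called philandering if it is not constant on any interval of positive length. It is implicit in (ii) that all function values occurring there are defined.
   Formalization: Added hypothesis, without which the claim is false: every x in I_{s*} equals λy for some (λ,y) in the set of (iii), or, if η(λ,s* )=s*, is itself the second entry of such a pair; otherwise (ii) leaves ξ_{s*}(x) arbitrary. Automatic if 1 ∈ J. *)

theory Defs
  imports "HOL-Analysis.Analysis"
begin

definition proper_interval :: "real set \<Rightarrow> bool" where
  "proper_interval T \<longleftrightarrow> is_interval T \<and> (\<exists>a\<in>T. \<exists>b\<in>T. a < b)"

definition philandering_on :: "(real \<Rightarrow> real) \<Rightarrow> real set \<Rightarrow> bool" where
  "philandering_on f A \<longleftrightarrow> (\<forall>T. proper_interval T \<and> T \<subseteq> A \<longrightarrow> \<not> f constant_on T)"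

definition total_domain :: "real set \<Rightarrow> (real \<Rightarrow> real set) \<Rightarrow> (real \<times> real) set" where
  "total_domain S I = {(x, s). s \<in> S \<and> x \<in> I s}"

(* The set of pairs (l, x) for which the functional equation is required at s. With B a subset of
   {0<..} \<times> UNIV it automatically lies in the open positive quadrant. *)
definition admissible :: "real set \<Rightarrow> (real \<times> real) set \<Rightarrow> real \<Rightarrow> (real \<times> real) set" where
  "admissible J B s = {(l, x). l \<in> J \<and> (x, s) \<in> B \<and> (l * x, s) \<in> B}"

end

theory Submission
  imports Defs
begin

text \<open>
  Write \<open>f\<close> for \<open>\<xi> s'\<close>. Since \<open>\<eta> (\<cdot>, s')\<close> is a constant \<open>s\<^sub>0\<close>, the hypothesis says that
  \<open>f (l * x) = \<gamma> (l, s') * g x\<close> with \<open>g = \<xi> s\<^sub>0\<close>, on an open connected set \<open>A\<close> of pairs \<open>(l, x)\<close>. This is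
  Pexider's multiplicative equation on a restricted domain.

  If \<open>f\<close> vanished at some product \<open>l * x\<close>, one of the two factors would vanish, and moving the other
  argument would make \<open>f\<close> zero on a whole interval; a philandering \<open>f\<close> therefore has no zero among
  the products. Around a product \<open>z\<close> the function \<open>t \<mapsto> f (z * exp t) / f z\<close> is thus multiplicative
  and, being a square, positive, so that its logarithm is locally additive. Measurability makes
  this logarithm bounded near zero, by a Steinhaus argument
  (\<open>measurable_imp_bounded_difference_under_scaling\<close>), and a bounded locally additive function is
  linear (\<open>locally_additive_bounded_imp_linear\<close>). Hence \<open>f\<close> agrees near every product with a nonzero
  multiple of a power (\<open>pexider_power_germ\<close>).

  A power law is determined by its germ at one point, so the germs fit together along a connected
  set (\<open>connected_power_germs_imp_power\<close>). This settles the set \<open>P\<close> of products, the image of \<open>A\<close>. By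
  the remaining hypothesis a point of \<open>I s'\<close> outside \<open>P\<close> lies in the projection \<open>Q\<close> of \<open>A\<close> to the second
  coordinate, and its existence forces \<open>s\<^sub>0 = s'\<close>, that is \<open>g = f\<close>. Then the functional equation carries
  the germs from \<open>P\<close> to \<open>Q\<close>, so \<open>f\<close> is a power law on \<open>Q\<close> as well; and since \<open>P\<close> and \<open>Q\<close> are open and
  cover the interval \<open>I s'\<close>, they meet, which identifies the two power laws.
\<close>

section \<open>Bounded increments of measurable functions under scaling\<close>

text \<open>
  The sets \<open>E n\<close> where \<open>g\<close> is bounded by \<open>n\<close> exhaust the interval, so one of them fills more than half of
  it. Its image under scaling by \<open>l\<close> close to 1 lies in nearly the same interval and has nearly the same measure,
  so the two sets overlap; a common point gives the required \<open>y\<close>.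
\<close>

lemma measurable_imp_bounded_difference_under_scaling:
  fixes g :: "real \<Rightarrow> real"
  assumes "a < b" and g: "g \<in> borel_measurable (lebesgue_on {a..b})"
  shows "\<exists>M. \<forall>\<^sub>F l in nhds 1. \<exists>y\<in>{a..b}. l * y \<in> {a..b} \<and> \<bar>g (l * y) - g y\<bar> \<le> M"
proof -
  define E where "E n = {x \<in> {a..b}. \<bar>g x\<bar> \<le> real n}" for n
  have sets: "E n \<in> sets lebesgue" for n
  proof -
    have "{x \<in> space (lebesgue_on {a..b}). \<bar>g x\<bar> \<le> real n} \<in> sets (lebesgue_on {a..b})"
      using g by measurable
    then show ?thesis
      by (simp add: E_def space_restrict_space sets_restrict_space_iff)
  qed
  have lm: "E n \<in> lmeasurable" for n
    by (rule fmeasurableI2[OF _ _ sets, of "{a..b}"]) (auto simp: E_def)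
  have Un: "(\<Union>n. E n) = {a..b}"
    unfolding E_def using real_arch_simple by auto
  have "(\<lambda>n. measure lebesgue (E n)) \<longlonglongrightarrow> measure lebesgue (\<Union>n. E n)"
    by (rule Lim_measure_incseq) (use sets in \<open>auto simp: Un emeasure_lborel_Icc_eq, auto simp: E_def incseq_def\<close>)
  then have "(\<lambda>n. measure lebesgue (E n)) \<longlonglongrightarrow> b - a"
    using \<open>a < b\<close> by (simp add: Un)
  then have "\<forall>\<^sub>F n in sequentially. (b - a) / 2 < measure lebesgue (E n)"
    by (rule order_tendstoD) (use \<open>a < b\<close> in simp)
  then obtain n where n: "(b - a) / 2 < measure lebesgue (E n)"
    by (auto simp: eventually_sequentially)
  \<comment> \<open>At \<open>l = 1\<close> the two sets have total measure \<open>2 * \<mu>\<close>, more than the length \<open>b - a\<close> of the interval that contains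
    both; by continuity this persists for \<open>l\<close> near 1.\<close>
  define \<mu> where "\<mu> = measure lebesgue (E n)"
  have "((\<lambda>l. (1 + l) * \<mu> - (max b (l * b) - min a (l * a))) \<longlongrightarrow>
          (1 + 1) * \<mu> - (max b (1 * b) - min a (1 * a))) (nhds 1)"
    by (intro tendsto_intros filterlim_ident)
  then have ev1: "\<forall>\<^sub>F l in nhds 1. 0 < (1 + l) * \<mu> - (max b (l * b) - min a (l * a))"
    by (rule order_tendstoD) (use n in \<open>simp add: \<mu>_def\<close>)
  have ev2: "\<forall>\<^sub>F l in nhds 1. (0::real) < l"
    by (rule order_tendstoD[OF filterlim_ident]) simp
  show ?thesis
  proof (intro exI[of _ "2 * real n"], rule eventually_mono[OF eventually_conj[OF ev1 ev2]])
    fix l :: real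
    assume l: "0 < (1 + l) * \<mu> - (max b (l * b) - min a (l * a)) \<and> 0 < l"
    define L where "L = (*) l ` E n"
    have "L = (*\<^sub>R) (1 / l) -` E n \<inter> space lebesgue"
      using l by (force simp: L_def)
    then have "L \<in> sets lebesgue"
      using measurable_sets[OF lebesgue_measurable_scaling sets] by simp
    moreover have L_sub: "L \<subseteq> {l * a..l * b}"
      using l by (auto simp: L_def E_def)
    ultimately have L: "L \<in> lmeasurable"
      by (intro bounded_set_imp_lmeasurable bounded_subset[OF bounded_closed_interval])
    have \<mu>L: "measure lebesgue L = l * \<mu>"
      using measure_lebesgue_affine[of l 0 "E n"] l by (simp add: L_def \<mu>_def)
    have "E n \<inter> L \<noteq> {}"
    proof
      assume disj: "E n \<inter> L = {}"
      have "measure lebesgue (E n \<union> L) = \<mu> + l * \<mu>"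
        using measure_Un3[OF lm L, of n] disj by (simp add: \<mu>L \<mu>_def)
      moreover have "measure lebesgue (E n \<union> L) \<le> measure lebesgue {min a (l * a)..max b (l * b)}"
      proof (rule measure_mono_fmeasurable)
        show "E n \<union> L \<subseteq> {min a (l * a)..max b (l * b)}"
          using L_sub by (fastforce simp: E_def min_le_iff_disj le_max_iff_disj)
      qed (use lm L in auto)
      moreover have "measure lebesgue {min a (l * a)..max b (l * b)} = max b (l * b) - min a (l * a)"
        using \<open>a < b\<close> by (subst measure_completion) auto
      moreover have "(1 + l) * \<mu> = \<mu> + l * \<mu>"
        by (simp add: distrib_right)
      ultimately show False
        using conjunct1[OF l] by linarith
    qed
    then obtain y where "y \<in> E n" "l * y \<in> E n"
      by (auto simp: L_def)
    then show "\<exists>y\<in>{a..b}. l * y \<in> {a..b} \<and> \<bar>g (l * y) - g y\<bar> \<le> 2 * real n"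
      by (intro bexI[of _ y]) (auto simp: E_def)
  qed
qed

section \<open>Local solutions of Cauchy's equations\<close>

text \<open>
  Subtract the linear function that agrees with \<open>h\<close> at a small point \<open>e\<close>. The difference \<open>k\<close> is additive and
  vanishes at \<open>e\<close>, so for \<open>t\<close> in \<open>{0..e}\<close> doubling \<open>t\<close> modulo \<open>e\<close> doubles \<open>k t\<close>. Every bound of \<open>k\<close> on \<open>{0..e}\<close>
  can therefore be halved, which forces \<open>k = 0\<close> there; additivity carries this to all of the domain.
\<close>

lemma locally_additive_bounded_imp_linear:
  fixes h :: "real \<Rightarrow> real"
  assumes add: "\<And>a b. \<bar>a\<bar> < d \<Longrightarrow> \<bar>b\<bar> < d \<Longrightarrow> \<bar>a + b\<bar> < d \<Longrightarrow> h (a + b) = h a + h b"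
    and pos: "d > 0" "r > 0"
    and bdd: "\<And>t. \<bar>t\<bar> < r \<Longrightarrow> \<bar>h t\<bar> \<le> M"
  shows "\<exists>c. \<forall>t. \<bar>t\<bar> < d \<longrightarrow> h t = c * t"
proof -
  define e where "e = min r d / 3"
  have e: "0 < e" "e < r" "2 * e < d"
    using pos by (auto simp: e_def)
  define c where "c = h e / e"
  define k where "k t = h t - c * t" for t
  have k_add: "k (a + b) = k a + k b" if "\<bar>a\<bar> < d" "\<bar>b\<bar> < d" "\<bar>a + b\<bar> < d" for a b
    using add[OF that] by (simp add: k_def algebra_simps)
  have "k e = 0"
    using e by (simp add: k_def c_def)
  have "k 0 = 0"
    using k_add[of 0 0] pos by simp
  have k_minus: "k (- t) = - k t" if "\<bar>t\<bar> < d" for t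
    using k_add[of t "- t"] that pos \<open>k 0 = 0\<close> by simp
  have halving: "\<bar>k t\<bar> \<le> (M + \<bar>c\<bar> * e) / 2 ^ n" if "t \<in> {0..e}" for t and n :: nat
    using that
  proof (induction n arbitrary: t)
    case 0
    have "\<bar>c * t\<bar> \<le> \<bar>c\<bar> * e"
      using 0 by (simp add: abs_mult mult_left_mono)
    moreover have "\<bar>h t\<bar> \<le> M"
      using 0 e by (intro bdd) auto
    ultimately show ?case
      by (simp add: k_def)
  next
    case (Suc n)
    have two: "k (t + t) = k t + k t"
      using Suc.prems e by (intro k_add) auto
    (* reduce 2t modulo e, at no cost because k e = 0 *)
    define u where "u = (if t + t \<le> e then t + t else t + t - e)"
    have "k u = 2 * k t"
    proof (cases "t + t \<le> e")
      case False
      have "k ((t + t - e) + e) = k (t + t - e) + k e"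
        using False Suc.prems e by (intro k_add) auto
      then show ?thesis
        using False two \<open>k e = 0\<close> by (simp add: u_def)
    qed (use two in \<open>simp add: u_def\<close>)
    moreover have "\<bar>k u\<bar> \<le> (M + \<bar>c\<bar> * e) / 2 ^ n"
      using Suc.prems by (intro Suc.IH) (auto simp: u_def)
    ultimately show ?case
      by (simp add: abs_mult field_simps)
  qed
  have k0: "k t = 0" if "t \<in> {0..e}" for t
  proof -
    have "(\<lambda>n. (M + \<bar>c\<bar> * e) / 2 ^ n) \<longlonglongrightarrow> 0"
      by (rule LIMSEQ_divide_realpow_zero) simp
    then have "\<bar>k t\<bar> \<le> 0"
      using halving[OF that] by (intro LIMSEQ_le_const) auto
    then show ?thesis by simp
  qed
  have k_small: "k t = 0" if "\<bar>t\<bar> \<le> e" for t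
    using k0[of t] k0[of "- t"] k_minus[of t] that e by (cases "t \<ge> 0") auto
  have doubling: "k t = 0" if "\<bar>t\<bar> < d" "\<bar>t\<bar> \<le> 2 ^ n * e" for t and n :: nat
    using that
  proof (induction n arbitrary: t)
    case (Suc n)
    have "k (t / 2 + t / 2) = k (t / 2) + k (t / 2)"
      using Suc.prems by (intro k_add) auto
    moreover have "k (t / 2) = 0"
      using Suc.prems by (intro Suc.IH) auto
    ultimately show ?case by simp
  qed (simp add: k_small)
  show ?thesis
  proof (intro exI allI impI)
    fix t assume "\<bar>t\<bar> < d"
    obtain n where "d / e < 2 ^ n"
      using real_arch_pow[of 2 "d / e"] by auto
    then have "\<bar>t\<bar> \<le> 2 ^ n * e"
      using \<open>\<bar>t\<bar> < d\<close> e by (simp add: field_simps)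
    then show "h t = c * t"
      using doubling[OF \<open>\<bar>t\<bar> < d\<close>] by (simp add: k_def)
  qed
qed

text \<open>
  The quotient \<open>\<phi> t / \<phi> 0\<close> is a nonzero square, so its logarithm exists and is locally additive. The point \<open>u\<close> in
  the boundedness hypothesis may depend on \<open>t\<close>, because an increment of an additive function
  does not depend on where it is taken.
\<close>

lemma locally_multiplicative_imp_exponential:
  fixes \<phi> :: "real \<Rightarrow> real"
  assumes mult: "\<And>a b. \<bar>a\<bar> < d \<Longrightarrow> \<bar>b\<bar> < d \<Longrightarrow> \<phi> (a + b) * \<phi> 0 = \<phi> a * \<phi> b"
    and "\<phi> 0 \<noteq> 0" "d > 0" "r > 0"
    and bdd: "\<And>t. \<bar>t\<bar> < r \<Longrightarrow> \<exists>u. \<bar>u\<bar> < d \<and> \<bar>u + t\<bar> < d \<and> \<bar>ln \<bar>\<phi> (u + t)\<bar> - ln \<bar>\<phi> u\<bar>\<bar> \<le> M"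
  shows "\<exists>c. \<forall>t. \<bar>t\<bar> < d \<longrightarrow> \<phi> t = \<phi> 0 * exp (c * t)"
proof -
  have pos: "\<phi> t / \<phi> 0 > 0" if "\<bar>t\<bar> < d" for t
  proof -
    have "\<phi> t * \<phi> (- t) \<noteq> 0"
      using mult[of t "- t"] that \<open>\<phi> 0 \<noteq> 0\<close> by (metis abs_minus_cancel add.right_inverse mult_eq_0_iff)
    moreover have "\<phi> t * \<phi> 0 = (\<phi> (t / 2))\<^sup>2"
      using mult[of "t / 2" "t / 2"] that by (simp add: power2_eq_square)
    ultimately have "\<phi> t * \<phi> 0 > 0"
      using \<open>\<phi> 0 \<noteq> 0\<close> by (metis mult_eq_0_iff zero_less_power2 zero_eq_power2)
    then show ?thesis
      by (auto simp: zero_less_divide_iff zero_less_mult_iff)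
  qed
  define h where "h t = ln (\<phi> t / \<phi> 0)" for t
  have h_add: "h (a + b) = h a + h b" if "\<bar>a\<bar> < d" "\<bar>b\<bar> < d" for a b
  proof -
    have "\<phi> (a + b) / \<phi> 0 = (\<phi> a / \<phi> 0) * (\<phi> b / \<phi> 0)"
      using mult[OF that] \<open>\<phi> 0 \<noteq> 0\<close> by (simp add: field_simps)
    then show ?thesis
      using pos[OF that(1)] pos[OF that(2)] unfolding h_def by (metis ln_mult_pos)
  qed
  have h_ln: "h t = ln \<bar>\<phi> t\<bar> - ln \<bar>\<phi> 0\<bar>" if "\<bar>t\<bar> < d" for t
  proof -
    have "\<phi> t / \<phi> 0 = \<bar>\<phi> t\<bar> / \<bar>\<phi> 0\<bar>" and "\<phi> t \<noteq> 0"
      using pos[OF that] by (auto simp flip: abs_divide)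
    then show ?thesis
      using \<open>\<phi> 0 \<noteq> 0\<close> by (simp add: h_def ln_div)
  qed
  have "\<bar>h t\<bar> \<le> M" if t: "\<bar>t\<bar> < min r d" for t
  proof -
    obtain u where u: "\<bar>u\<bar> < d" "\<bar>u + t\<bar> < d" "\<bar>ln \<bar>\<phi> (u + t)\<bar> - ln \<bar>\<phi> u\<bar>\<bar> \<le> M"
      using bdd[of t] t by auto
    have "h t = h (u + t) - h u"
      using h_add[of u t] u t by simp
    then show ?thesis
      using u by (simp add: h_ln)
  qed
  then obtain c where c: "\<And>t. \<bar>t\<bar> < d \<Longrightarrow> h t = c * t"
    using locally_additive_bounded_imp_linear[of d h "min r d" M] h_add \<open>d > 0\<close> \<open>r > 0\<close> by auto
  show ?thesis
  proof (intro exI allI impI)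
    fix t assume t: "\<bar>t\<bar> < d"
    have "\<phi> t / \<phi> 0 = exp (c * t)"
      using c[OF t] pos[OF t] by (metis h_def exp_ln)
    then show "\<phi> t = \<phi> 0 * exp (c * t)"
      using \<open>\<phi> 0 \<noteq> 0\<close> by (simp add: field_simps)
  qed
qed

section \<open>Germs of power functions\<close>

lemma power_germ_unique:
  fixes z :: real
  assumes "z > 0" "\<kappa> \<noteq> 0" and ev: "\<forall>\<^sub>F x in nhds z. \<kappa> * x powr \<rho> = \<kappa>' * x powr \<rho>'"
  shows "\<kappa> = \<kappa>' \<and> \<rho> = \<rho>'"
proof -
  have "\<forall>\<^sub>F x in at_right z. z < x \<and> \<kappa> * x powr \<rho> = \<kappa>' * x powr \<rho>'"
    using ev by (auto simp: eventually_at_filter elim: eventually_mono)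
  then obtain y where "z < y" and y: "\<kappa> * y powr \<rho> = \<kappa>' * y powr \<rho>'"
    using eventually_happens'[OF trivial_limit_at_right_real] by blast
  have z: "\<kappa> * z powr \<rho> = \<kappa>' * z powr \<rho>'"
    using ev by (rule eventually_nhds_x_imp_x)
  then have "\<kappa>' \<noteq> 0"
    using \<open>0 < z\<close> \<open>\<kappa> \<noteq> 0\<close> by auto
  have "(y / z) powr \<rho> = (\<kappa> * y powr \<rho>) / (\<kappa> * z powr \<rho>)"
    using \<open>0 < z\<close> \<open>z < y\<close> \<open>\<kappa> \<noteq> 0\<close> by (simp add: powr_divide)
  also have "\<dots> = (y / z) powr \<rho>'"
    unfolding y z using \<open>0 < z\<close> \<open>z < y\<close> \<open>\<kappa>' \<noteq> 0\<close> by (simp add: powr_divide)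
  finally have "\<rho> = \<rho>'"
    using \<open>0 < z\<close> \<open>z < y\<close> by (subst (asm) powr_inj) auto
  then show ?thesis
    using z \<open>0 < z\<close> by simp
qed

text \<open>
  By uniqueness of the germ, coefficient and exponent are locally constant functions of the base
  point. The coefficients must be nonzero, as the exponent of the zero function is arbitrary.
\<close>

lemma connected_power_germs_imp_power:
  fixes f :: "real \<Rightarrow> real"
  assumes "connected C" "C \<subseteq> {0<..}"
    and germ: "\<And>z. z \<in> C \<Longrightarrow> \<exists>\<kappa> \<rho>. \<kappa> \<noteq> 0 \<and> (\<forall>\<^sub>F x in nhds z. f x = \<kappa> * x powr \<rho>)"
  shows "\<exists>\<kappa> \<rho>. \<kappa> \<noteq> 0 \<and> (\<forall>x\<in>C. f x = \<kappa> * x powr \<rho>)"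
proof (cases "C = {}")
  case False
  then obtain c where "c \<in> C" by blast
  obtain K R where K: "\<And>z. z \<in> C \<Longrightarrow> K z \<noteq> 0"
    and KR: "\<And>z. z \<in> C \<Longrightarrow> \<forall>\<^sub>F x in nhds z. f x = K z * x powr R z"
    using germ by metis
  have "\<forall>\<^sub>F b in at a within C. (K a, R a) = (K b, R b)" if "a \<in> C" for a
  proof -
    have "\<forall>\<^sub>F b in nhds a. \<forall>\<^sub>F x in nhds b. f x = K a * x powr R a"
      using KR[OF that] by (subst eventually_eventually)
    then have "\<forall>\<^sub>F b in nhds a. b \<in> C \<longrightarrow> (K a, R a) = (K b, R b)"
    proof (rule eventually_mono, intro impI)
      fix b assume ev: "\<forall>\<^sub>F x in nhds b. f x = K a * x powr R a" and "b \<in> C"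
      have "\<forall>\<^sub>F x in nhds b. K b * x powr R b = K a * x powr R a"
        using KR[OF \<open>b \<in> C\<close>] ev by eventually_elim simp
      then have "K b = K a \<and> R b = R a"
        using K \<open>b \<in> C\<close> \<open>C \<subseteq> {0<..}\<close> by (intro power_germ_unique[of b]) auto
      then show "(K a, R a) = (K b, R b)"
        by simp
    qed
    then show ?thesis
      by (auto simp: eventually_at_filter elim: eventually_mono)
  qed
  then have const: "(K c, R c) = (K x, R x)" if "x \<in> C" for x
    using connected_local_const[OF \<open>connected C\<close> \<open>c \<in> C\<close> that, of "\<lambda>z. (K z, R z)"] by blast
  have "f x = K c * x powr R c" if "x \<in> C" for x
    using eventually_nhds_x_imp_x[OF KR[OF that]] const[OF that] by simp
  then show ?thesis
    using K[OF \<open>c \<in> C\<close>] by blast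
qed auto

section \<open>The functional equation on an open set\<close>

text \<open>
  In the exponential coordinates \<open>l = l\<^sub>0 * exp a\<close>, \<open>x = x\<^sub>0 * exp b\<close> the equation reads \<open>\<phi> (a + b) = p a * q b\<close> on a
  square around the origin, and eliminating \<open>p\<close> and \<open>q\<close> leaves \<open>\<phi> (a + b) * \<phi> 0 = \<phi> a * \<phi> b\<close>. The value \<open>\<phi> 0\<close> is nonzero
  because \<open>f\<close> is philandering. Measurability is used in the original coordinate, on a compact interval \<open>T\<close>
  around \<open>l\<^sub>0 * x\<^sub>0\<close>: scaling there is translation in the new coordinate.
\<close>

lemma pexider_power_germ:
  fixes f \<gamma> g :: "real \<Rightarrow> real"
  assumes "open A" "(l\<^sub>0, x\<^sub>0) \<in> A" "l\<^sub>0 > 0" "x\<^sub>0 > 0"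
    and eq: "\<And>l x. (l, x) \<in> A \<Longrightarrow> l * x \<in> I \<and> f (l * x) = \<gamma> l * g x"
    and f: "philandering_on f I" "f \<in> borel_measurable (lebesgue_on I)"
  shows "\<exists>\<kappa> \<rho>. \<kappa> \<noteq> 0 \<and> (\<forall>\<^sub>F x in nhds (l\<^sub>0 * x\<^sub>0). f x = \<kappa> * x powr \<rho>)"
proof -
  define z where "z = l\<^sub>0 * x\<^sub>0"
  have "z > 0"
    using assms by (simp add: z_def)
  have "open ((\<lambda>(a, b). (l\<^sub>0 * exp a, x\<^sub>0 * exp b)) -` A)" (is "open ?W")
    by (rule open_vimage[OF \<open>open A\<close>]) (auto simp: case_prod_unfold intro!: continuous_intros)
  moreover have "(0, 0) \<in> ?W"
    using assms by simp
  ultimately obtain U V where "open U" "open V" "(0, 0) \<in> U \<times> V" "U \<times> V \<subseteq> ?W"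
    by (rule open_prod_elim)
  then have "\<forall>\<^sub>F t in nhds 0. t \<in> U \<inter> V"
    by (intro eventually_nhds_in_open) auto
  then obtain d where "d > 0" and d: "\<And>t. \<bar>t\<bar> < d \<Longrightarrow> t \<in> U \<inter> V"
    by (auto simp: eventually_nhds_metric)
  have A: "(l\<^sub>0 * exp a, x\<^sub>0 * exp b) \<in> A" if "\<bar>a\<bar> < d" "\<bar>b\<bar> < d" for a b
    using d[OF that(1)] d[OF that(2)] \<open>U \<times> V \<subseteq> ?W\<close> by auto
  define \<phi> where "\<phi> t = f (z * exp t)" for t
  define p where "p a = \<gamma> (l\<^sub>0 * exp a)" for a
  define q where "q b = g (x\<^sub>0 * exp b)" for b
  have \<phi>: "\<phi> (a + b) = p a * q b" if "\<bar>a\<bar> < d" "\<bar>b\<bar> < d" for a b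
    using eq[OF A[OF that]] by (simp add: \<phi>_def p_def q_def z_def exp_add mult_ac)
  have I: "z * exp t \<in> I" if "\<bar>t\<bar> < d" for t
    using eq[OF A[OF that, of 0]] \<open>d > 0\<close> by (simp add: z_def mult_ac)
  define T where "T = {z * exp (- (d / 2))..z * exp (d / 2)}"
  have T_iff: "z * exp t \<in> T \<longleftrightarrow> \<bar>t\<bar> \<le> d / 2" for t
    using \<open>z > 0\<close> by (auto simp: T_def)
  have exp_ex: "\<exists>t. x = z * exp t" if "x > 0" for x
    using that \<open>z > 0\<close> by (intro exI[of _ "ln (x / z)"]) simp
  have T: "\<exists>t. \<bar>t\<bar> \<le> d / 2 \<and> x = z * exp t" if "x \<in> T" for x
  proof -
    have "0 < z * exp (- (d / 2))" using \<open>z > 0\<close> by simp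
    then have "x > 0" using that unfolding T_def by (meson atLeastAtMost_iff less_le_trans)
    then show ?thesis using exp_ex T_iff that by blast
  qed
  have "T \<subseteq> I"
    using T I \<open>d > 0\<close> by fastforce
  have T_less: "z * exp (- (d / 2)) < z * exp (d / 2)"
    using \<open>z > 0\<close> \<open>d > 0\<close> by simp
  have "proper_interval T"
    unfolding proper_interval_def T_def
    by (intro conjI is_interval_cc bexI[OF _ ] T_less) (use T_less in auto)
  have "\<phi> 0 \<noteq> 0"
  proof
    assume "\<phi> 0 = 0"
    then have pq: "p 0 = 0 \<or> q 0 = 0"
      using \<phi>[of 0 0] \<open>d > 0\<close> by simp
    have "\<phi> t = 0" if "\<bar>t\<bar> < d" for t
      using pq \<phi>[of 0 t] \<phi>[of t 0] that \<open>d > 0\<close> by auto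
    then have "f x = 0" if "x \<in> T" for x
      using T[OF that] \<open>d > 0\<close> by (auto simp: \<phi>_def)
    then have "f constant_on T"
      by (auto simp: constant_on_def)
    then show False
      using f(1) \<open>proper_interval T\<close> \<open>T \<subseteq> I\<close> by (auto simp: philandering_on_def)
  qed
  have [measurable]: "f \<in> borel_measurable (lebesgue_on T)"
    using f(2) \<open>T \<subseteq> I\<close> by (rule measurable_restrict_mono)
  have "(\<lambda>x. ln \<bar>f x\<bar>) \<in> borel_measurable (lebesgue_on T)"
    by measurable
  then obtain M where "\<forall>\<^sub>F l in nhds 1. \<exists>y\<in>T. l * y \<in> T \<and> \<bar>ln \<bar>f (l * y)\<bar> - ln \<bar>f y\<bar>\<bar> \<le> M"
    using measurable_imp_bounded_difference_under_scaling[OF T_less] unfolding T_def by blast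
  moreover have "((\<lambda>t. exp t) \<longlongrightarrow> exp 0) (nhds (0::real))"
    by (intro tendsto_intros filterlim_ident)
  then have "filterlim exp (nhds 1) (nhds (0::real))" by simp
  ultimately have "\<forall>\<^sub>F t in nhds 0. \<exists>y\<in>T. exp t * y \<in> T \<and> \<bar>ln \<bar>f (exp t * y)\<bar> - ln \<bar>f y\<bar>\<bar> \<le> M"
    by (rule eventually_compose_filterlim)
  then obtain r where "r > 0"
    and r: "\<And>t. \<bar>t\<bar> < r \<Longrightarrow> \<exists>y\<in>T. exp t * y \<in> T \<and> \<bar>ln \<bar>f (exp t * y)\<bar> - ln \<bar>f y\<bar>\<bar> \<le> M"
    by (auto simp: eventually_nhds_metric)
  have "\<exists>u. \<bar>u\<bar> < d \<and> \<bar>u + t\<bar> < d \<and> \<bar>ln \<bar>\<phi> (u + t)\<bar> - ln \<bar>\<phi> u\<bar>\<bar> \<le> M" if t: "\<bar>t\<bar> < r" for t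
  proof -
    obtain y where y: "y \<in> T" "exp t * y \<in> T" "\<bar>ln \<bar>f (exp t * y)\<bar> - ln \<bar>f y\<bar>\<bar> \<le> M"
      using r[OF t] by blast
    obtain u where u: "\<bar>u\<bar> \<le> d / 2" "y = z * exp u"
      using T[OF y(1)] by blast
    have e: "exp t * y = z * exp (u + t)"
      by (simp add: u exp_add)
    have "\<bar>u + t\<bar> \<le> d / 2"
      using y(2) unfolding e T_iff .
    then show ?thesis
      using u y(3) \<open>d > 0\<close> unfolding e by (intro exI[of _ u]) (auto simp: \<phi>_def)
  qed
  moreover have "\<phi> (a + b) * \<phi> 0 = \<phi> a * \<phi> b" if "\<bar>a\<bar> < d" "\<bar>b\<bar> < d" for a b
    using \<phi>[OF that] \<phi>[of 0 0] \<phi>[of a 0] \<phi>[of 0 b] that \<open>d > 0\<close> by simp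
  ultimately obtain c where c: "\<And>t. \<bar>t\<bar> < d \<Longrightarrow> \<phi> t = \<phi> 0 * exp (c * t)"
    using locally_multiplicative_imp_exponential[of d \<phi> r M] \<open>\<phi> 0 \<noteq> 0\<close> \<open>d > 0\<close> \<open>r > 0\<close> by auto
  have "\<forall>\<^sub>F x in nhds z. x \<in> {z * exp (- d)<..<z * exp d}"
    using \<open>z > 0\<close> \<open>d > 0\<close> by (intro eventually_nhds_in_open) auto
  then have "\<forall>\<^sub>F x in nhds z. f x = (\<phi> 0 * z powr (- c)) * x powr c"
  proof eventually_elim
    case (elim x)
    have "0 < z * exp (- d)" using \<open>z > 0\<close> by simp
    then have "x > 0" using elim by (meson greaterThanLessThan_iff less_trans)
    then obtain t where t: "x = z * exp t" using exp_ex by blast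
    then have "\<bar>t\<bar> < d" using elim \<open>z > 0\<close> by auto
    then have "f x = \<phi> 0 * exp (c * t)"
      using c[of t] by (simp add: \<phi>_def t)
    also have "exp (c * t) = z powr (- c) * x powr c"
      using \<open>z > 0\<close> by (simp add: t powr_def ln_mult_pos algebra_simps flip: exp_add)
    finally show ?case by simp
  qed
  moreover have "\<phi> 0 * z powr (- c) \<noteq> 0"
    using \<open>\<phi> 0 \<noteq> 0\<close> \<open>z > 0\<close> by simp
  ultimately show ?thesis
    unfolding z_def by blast
qed

text \<open>The image is a union of scaled slices of \<open>A\<close>.\<close>

lemma open_product_image:
  fixes A :: "(real \<times> real) set"
  assumes "open A" "\<And>l x. (l, x) \<in> A \<Longrightarrow> l \<noteq> 0"
  shows "open ((\<lambda>(l, x). l * x) ` A)"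
proof -
  have "(\<lambda>(l, x). l * x) ` A = (\<Union>l\<in>fst ` A. (*) l ` (Pair l -` A))"
    by force
  moreover have "open ((*) l ` (Pair l -` A))" if "l \<in> fst ` A" for l
  proof -
    have "open (Pair l -` A)"
      by (rule open_vimage[OF \<open>open A\<close>]) (intro continuous_intros)
    moreover have "l \<noteq> 0"
      using that assms(2) by force
    ultimately show ?thesis
      using open_scaling[of l "Pair l -` A"] by simp
  qed
  ultimately show ?thesis
    by auto
qed

theorem theorem1:
  fixes S J :: "real set"
    and I :: "real \<Rightarrow> real set"
    and \<xi> :: "real \<Rightarrow> real \<Rightarrow> real"
    and B :: "(real \<times> real) set"
    and \<gamma> \<eta> :: "real \<times> real \<Rightarrow> real"
    and s' :: real
  defines "B \<equiv> total_domain S I"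
  assumes "proper_interval S" and "proper_interval J"
    and "\<And>s. s \<in> S \<Longrightarrow> proper_interval (I s) \<and> I s \<subseteq> {0<..}"
    and "\<eta> \<in> J \<times> S \<rightarrow> S"
    and "s' \<in> S"
    and i: "(\<lambda>l. \<eta> (l, s')) constant_on J"
           "philandering_on (\<xi> s') (I s')"
           "\<xi> s' \<in> borel_measurable (lebesgue_on (I s'))"
    and ii: "\<And>l x. l \<in> J \<Longrightarrow> (x, s') \<in> B \<Longrightarrow> (l * x, s') \<in> B \<Longrightarrow>
               (x, \<eta> (l, s')) \<in> B \<and> \<xi> s' (l * x) = \<gamma> (l, s') * \<xi> (\<eta> (l, s')) x"
    and iii: "open (admissible J B s')" "connected (admissible J B s')"
    (* Every value of \<xi> s' on I s' occurs in some instance of (ii). Needed: otherwise (ii) leaves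
       \<xi> s' unconstrained at such points. Automatic if 1 is in J. *)
    and occurs: "\<And>x. x \<in> I s' \<Longrightarrow>
               \<exists>(l, y) \<in> admissible J B s'. x = l * y \<or> (x = y \<and> \<eta> (l, s') = s')"
  shows "\<exists>\<kappa> \<rho>. \<forall>x\<in>I s'. \<xi> s' x = \<kappa> * x powr \<rho>"
proof -
  define A where "A = admissible J B s'"
  define f where "f = \<xi> s'"
  obtain s\<^sub>0 where s\<^sub>0: "\<And>l. l \<in> J \<Longrightarrow> \<eta> (l, s') = s\<^sub>0"
    using i(1) by (auto simp: constant_on_def)
  define g where "g = \<xi> s\<^sub>0"
  have A: "l \<in> J" "x \<in> I s'" "l * x \<in> I s'" "f (l * x) = \<gamma> (l, s') * g x" "0 < x" "0 < l"
    if "(l, x) \<in> A" for l x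
  proof -
    show *: "l \<in> J" "x \<in> I s'" "l * x \<in> I s'"
      using that by (auto simp: A_def admissible_def B_def total_domain_def)
    show "f (l * x) = \<gamma> (l, s') * g x"
      using ii[of l x] that * s\<^sub>0 by (auto simp: A_def admissible_def f_def g_def)
    have "0 < x" "0 < l * x"
      using * assms(4)[OF \<open>s' \<in> S\<close>] by auto
    then show "0 < x" "0 < l"
      by (auto simp: zero_less_mult_iff)
  qed
  have "open A" "connected A"
    using iii by (auto simp: A_def)
  define P Q where "P = (\<lambda>(l, x). l * x) ` A" and "Q = snd ` A"
  have "connected P" "connected Q"
    unfolding P_def Q_def case_prod_unfold
    by (intro connected_continuous_image continuous_intros \<open>connected A\<close>)+
  have "open P"
    unfolding P_def using A(6) by (intro open_product_image \<open>open A\<close>) fastforce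
  have "open Q"
    unfolding Q_def using \<open>open A\<close> by (rule open_image_snd)
  have sub: "P \<subseteq> I s'" "Q \<subseteq> I s'"
    using A by (auto simp: P_def Q_def)
  have "I s' \<subseteq> {0<..}"
    using assms(4) \<open>s' \<in> S\<close> by blast
  have "\<exists>\<kappa> \<rho>. \<kappa> \<noteq> 0 \<and> (\<forall>x\<in>P. f x = \<kappa> * x powr \<rho>)"
  proof (rule connected_power_germs_imp_power[OF \<open>connected P\<close>])
    fix z assume "z \<in> P"
    then obtain l x where "(l, x) \<in> A" "z = l * x"
      by (auto simp: P_def)
    then show "\<exists>\<kappa> \<rho>. \<kappa> \<noteq> 0 \<and> (\<forall>\<^sub>F x in nhds z. f x = \<kappa> * x powr \<rho>)"
      using pexider_power_germ[OF \<open>open A\<close>, of l x "I s'" f "\<lambda>l. \<gamma> (l, s')" g] A i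
      by (simp add: f_def)
  qed (use sub \<open>I s' \<subseteq> {0<..}\<close> in blast)
  then obtain \<kappa> \<rho> where "\<kappa> \<noteq> 0" and P: "\<And>x. x \<in> P \<Longrightarrow> f x = \<kappa> * x powr \<rho>"
    by blast
  \<comment> \<open>A point that is not a product can only occur as an argument of \<open>g\<close>, which then equals \<open>f\<close>.\<close>
  have f_eq: "f x = \<kappa> * x powr \<rho>" if x: "x \<in> I s'" "x \<notin> P" for x
  proof -
    obtain l y where "(l, y) \<in> A" "x = l * y \<or> (x = y \<and> \<eta> (l, s') = s')"
      using occurs[OF x(1)] by (auto simp: A_def)
    then have "(l, x) \<in> A" "\<eta> (l, s') = s'"
      using x(2) by (auto simp: P_def)
    then have "x \<in> Q" "g = f"
      using s\<^sub>0 A(1) by (auto simp: Q_def f_def g_def intro!: image_eqI[where x = "(l, x)"])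
    have "\<exists>\<kappa> \<rho>. \<kappa> \<noteq> 0 \<and> (\<forall>x\<in>Q. f x = \<kappa> * x powr \<rho>)"
    proof (rule connected_power_germs_imp_power[OF \<open>connected Q\<close>])
      fix y assume "y \<in> Q"
      then obtain l where l: "(l, y) \<in> A"
        by (auto simp: Q_def)
      have "l * y \<in> P"
        using l by (force simp: P_def)
      then have "\<gamma> (l, s') \<noteq> 0"
        using P[of "l * y"] A(4-6)[OF l] \<open>\<kappa> \<noteq> 0\<close> by auto
      have "open (Pair l -` A)"
        by (rule open_vimage[OF \<open>open A\<close>]) (intro continuous_intros)
      then have "\<forall>\<^sub>F x in nhds y. x \<in> Pair l -` A"
        using l by (intro eventually_nhds_in_open) auto
      then have "\<forall>\<^sub>F x in nhds y. f x = (\<kappa> * l powr \<rho> / \<gamma> (l, s')) * x powr \<rho>"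
      proof eventually_elim
        case (elim x)
        then have x: "(l, x) \<in> A" by simp
        then have "l * x \<in> P"
          by (force simp: P_def)
        then have "\<gamma> (l, s') * f x = \<kappa> * (l * x) powr \<rho>"
          using A(4)[OF x] P \<open>g = f\<close> by simp
        then show ?case
          using A(5,6)[OF x] \<open>\<gamma> (l, s') \<noteq> 0\<close> by (simp add: powr_mult field_simps)
      qed
      moreover have "\<kappa> * l powr \<rho> / \<gamma> (l, s') \<noteq> 0"
        using \<open>\<kappa> \<noteq> 0\<close> \<open>\<gamma> (l, s') \<noteq> 0\<close> A(6)[OF l] by simp
      ultimately show "\<exists>\<kappa> \<rho>. \<kappa> \<noteq> 0 \<and> (\<forall>\<^sub>F x in nhds y. f x = \<kappa> * x powr \<rho>)"
        by blast
    qed (use sub \<open>I s' \<subseteq> {0<..}\<close> in blast)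
    then obtain \<kappa>' \<rho>' where Q: "\<And>x. x \<in> Q \<Longrightarrow> f x = \<kappa>' * x powr \<rho>'"
      by blast
    \<comment> \<open>The two power laws agree because \<open>P\<close> and \<open>Q\<close> cannot disconnect the interval \<open>I s'\<close>.\<close>
    have "I s' \<subseteq> P \<union> Q"
      using occurs by (force simp: A_def P_def Q_def)
    moreover have "connected (I s')"
      using assms(4)[OF \<open>s' \<in> S\<close>] by (simp add: proper_interval_def is_interval_connected_1)
    moreover have "l * x \<in> P"
      using \<open>(l, x) \<in> A\<close> by (force simp: P_def)
    ultimately obtain w where w: "w \<in> P \<inter> Q"
      using connectedD[of "I s'" P Q] \<open>open P\<close> \<open>open Q\<close> sub \<open>x \<in> Q\<close> by blast
    have "\<forall>\<^sub>F v in nhds w. v \<in> P \<inter> Q"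
      using w \<open>open P\<close> \<open>open Q\<close> by (intro eventually_nhds_in_open open_Int)
    then have "\<forall>\<^sub>F v in nhds w. \<kappa> * v powr \<rho> = \<kappa>' * v powr \<rho>'"
      by eventually_elim (metis P Q IntD1 IntD2)
    then have "\<kappa> = \<kappa>' \<and> \<rho> = \<rho>'"
      using w sub \<open>I s' \<subseteq> {0<..}\<close> \<open>\<kappa> \<noteq> 0\<close> by (intro power_germ_unique[of w]) auto
    then show ?thesis
      using Q \<open>x \<in> Q\<close> by simp
  qed
  show ?thesis
    using P f_eq unfolding f_def by blast
qed

end
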